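(* Let $\beta$ be a stable non-negative increasing sequence tending to infinity, let $K(a_{n,k})$ be a Köthe space, and let $\theta=(\theta_n)_{n\in\mathbb{N}_0}\in\Lambda_1(\beta)$. Assume that there exists $m\in\mathbb{N}$ such that for every $k\in\mathbb{N}$ there exists $C>0$ with $$e^{\frac1k\beta_n}\le C\,a_{n,m}\qquad\text{for all }n\in\mathbb{N}.$$ Then the Hankel operator $H_\theta:K(a_{n,k})\to\Lambda_1(\beta)$ is compact.
   Context: $\mathbb{N}=\{1,2,\dots\}$, $\mathbb{N}_0=\mathbb{N}\cup\{0\}$. A Köthe matrix is a matrix $(a_{n,k})_{n,k\in\mathbb{N}}$ of non-negative numbers such that for each $n$ there is $k$ with $a_{n,k}>0$, and $a_{n,k}\le a_{n,k+1}$ for all $n,k$. The associated Köthe space is the Fréchet space $K(a_{n,k})=\{x=(x_n)_{n\in\mathbb{N}}:\ \|x\|_k:=\sum_{n=1}^\infty|x_n|a_{n,k}<\infty\ \text{for all }k\in\mathbb{N}\}$ with seminorms $\|\cdot\|_k$, $k\in\mathbb{N}$. For a non-negative increasing sequence $\beta=(\beta_n)_{n\in\mathbb{N}}$ with $\beta_n\to\infty$, the power series space of finite type is $\Lambda_1(\beta)=K(e^{-\frac1k\beta_n})$, i.e. $\|x\|_k=\sum_{n=1}^\infty|x_n|e^{-\frac1k\beta_n}$. The sequence $\beta$ is stable if $\sup_{n\in\mathbb{N}}\beta_{2n}/\beta_n<\infty$, i.e. there is $M$ with $\beta_{2n}\le M\beta_n$ for all $n$. The sequence $e_n$ has $1$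 in the $n$-th place and $0$ elsewhere. A sequence $\theta=(\theta_n)_{n\in\mathbb{N}_0}$ is identified with the sequence $(\theta_{n-1})_{n\in\mathbb{N}}=(\theta_0,\theta_1,\theta_2,\dots)$ when it is said to belong to a sequence space. The Hankel operator $H_\theta$ from a Köthe space $E$ to a Köthe space $F$ is given by $H_\theta e_n=(\theta_{n-1},\theta_n,\theta_{n+1},\dots)=\sum_{j=1}^\infty\theta_{j+n-2}e_j$ for $n\in\mathbb{N}$ and $H_\theta x=\sum_{n=1}^\infty x_nH_\theta e_n$ for $x=(x_n)\in E$ (its existence as a map means that $H_\theta e_n\in F$ for all $n$ and the series converges in $F$ for every $x\in E$). A linear map $T:E\to F$ between Fréchet spaces is compact if $T(U)$ is precompact in $F$ for some neighborhood $U$ of zero in $E$. *)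

theory Defs
  imports "HOL-Analysis.Analysis"
begin

text \<open>
  Sequences indexed by \<open>\<nat> = {1, 2, \<dots>}\<close> are functions on \<^typ>\<open>nat\<close> whose value at \<open>0\<close> carries no
  information: elements of a sequence space are normalised to be \<open>0\<close> there, and for matrices
  and exponent sequences only the indices \<open>\<ge> 1\<close> are ever inspected.

  The scalars range over a type of class \<open>{real_normed_field, heine_borel}\<close>; both the real and the
  complex numbers are instances.
\<close>

definition kothe_matrix :: "(nat \<Rightarrow> nat \<Rightarrow> real) \<Rightarrow> bool" where
  "kothe_matrix a \<longleftrightarrow>
     (\<forall>n\<ge>1. \<forall>k\<ge>1. 0 \<le> a n k \<and> a n k \<le> a n (k + 1)) \<and> (\<forall>n\<ge>1. \<exists>k\<ge>1. 0 < a n k)"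

definition kothe_seminorm ::
    "(nat \<Rightarrow> nat \<Rightarrow> real) \<Rightarrow> nat \<Rightarrow> (nat \<Rightarrow> 'a::{real_normed_field, heine_borel}) \<Rightarrow> real" where
  "kothe_seminorm a k x = (\<Sum>n. norm (x (Suc n)) * a (Suc n) k)"

definition kothe_space ::
    "(nat \<Rightarrow> nat \<Rightarrow> real) \<Rightarrow> (nat \<Rightarrow> 'a::{real_normed_field, heine_borel}) set" where
  "kothe_space a = {x. x 0 = 0 \<and> (\<forall>k\<ge>1. summable (\<lambda>n. norm (x (Suc n)) * a (Suc n) k))}"

definition kothe_topology ::
    "(nat \<Rightarrow> nat \<Rightarrow> real) \<Rightarrow> (nat \<Rightarrow> 'a::{real_normed_field, heine_borel}) topology" where
  "kothe_topology a = topology_generated_by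
     {{y \<in> kothe_space a. kothe_seminorm a k (\<lambda>n. y n - x n) < r} | x k r.
        x \<in> kothe_space a \<and> 1 \<le> k \<and> 0 < r}"

lemma topspace_kothe_topology [simp]: "topspace (kothe_topology a) = kothe_space a"
proof (unfold kothe_topology_def topology_generated_by_topspace, intro equalityI subsetI)
  fix x :: "nat \<Rightarrow> 'a"
  assume x: "x \<in> kothe_space a"
  then have "x \<in> {y \<in> kothe_space a. kothe_seminorm a 1 (\<lambda>n. y n - x n) < 1}"
    by (simp add: kothe_seminorm_def)
  moreover have "{y \<in> kothe_space a. kothe_seminorm a 1 (\<lambda>n. y n - x n) < 1} \<in>
      {{y \<in> kothe_space a. kothe_seminorm a k (\<lambda>n. y n - x n) < r} | x k r.
        x \<in> kothe_space a \<and> 1 \<le> k \<and> 0 < r}"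
    by (intro CollectI exI[of _ x] exI[of _ "1::nat"] exI[of _ "1::real"]) (use x in simp)
  ultimately show "x \<in> \<Union> {{y \<in> kothe_space a. kothe_seminorm a k (\<lambda>n. y n - x n) < r} | x k r.
        x \<in> kothe_space a \<and> 1 \<le> k \<and> 0 < r}"
    by (rule UnionI[rotated])
qed blast

definition finite_type_matrix :: "(nat \<Rightarrow> real) \<Rightarrow> nat \<Rightarrow> nat \<Rightarrow> real" where
  "finite_type_matrix \<beta> n k = exp (- (1 / real k) * \<beta> n)"

abbreviation Lambda1 :: "(nat \<Rightarrow> real) \<Rightarrow> (nat \<Rightarrow> 'a::{real_normed_field, heine_borel}) topology" where
  "Lambda1 \<beta> \<equiv> kothe_topology (finite_type_matrix \<beta>)"

text \<open>Stated without quotients, since finitely many \<open>\<beta> n\<close> may vanish.\<close>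

definition stable_seq :: "(nat \<Rightarrow> real) \<Rightarrow> bool" where
  "stable_seq \<beta> \<longleftrightarrow> (\<exists>M. \<forall>n\<ge>1. \<beta> (2 * n) \<le> M * \<beta> n)"

text \<open>The identification of \<open>(\<theta>\<^sub>0, \<theta>\<^sub>1, \<dots>)\<close> with a sequence indexed from \<open>1\<close>.\<close>

definition shift_seq :: "(nat \<Rightarrow> 'a::zero) \<Rightarrow> nat \<Rightarrow> 'a" where
  "shift_seq \<theta> n = (if n = 0 then 0 else \<theta> (n - 1))"

text \<open>The image of the \<open>n\<close>-th unit vector, for \<open>n \<ge> 1\<close>.\<close>

definition hankel_column :: "(nat \<Rightarrow> 'a::zero) \<Rightarrow> nat \<Rightarrow> nat \<Rightarrow> 'a" where
  "hankel_column \<theta> n j = (if j = 0 then 0 else \<theta> (j + n - 2))"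

definition hankel_sums_to ::
    "(nat \<Rightarrow> 'a::{real_normed_field, heine_borel}) topology \<Rightarrow> (nat \<Rightarrow> 'a) \<Rightarrow>
     (nat \<Rightarrow> 'a) \<Rightarrow> (nat \<Rightarrow> 'a) \<Rightarrow> bool" where
  "hankel_sums_to Y \<theta> x y \<longleftrightarrow>
     limitin Y (\<lambda>N j. \<Sum>n = 1..N. x n * hankel_column \<theta> n j) y sequentially"

definition hankel_exists ::
    "(nat \<Rightarrow> 'a::{real_normed_field, heine_borel}) topology \<Rightarrow> (nat \<Rightarrow> 'a) topology \<Rightarrow>
     (nat \<Rightarrow> 'a) \<Rightarrow> bool" where
  "hankel_exists X Y \<theta> \<longleftrightarrow>
     (\<forall>n\<ge>1. hankel_column \<theta> n \<in> topspace Y) \<and> (\<forall>x\<in>topspace X. \<exists>y. hankel_sums_to Y \<theta> x y)"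

definition hankel_operator ::
    "(nat \<Rightarrow> 'a::{real_normed_field, heine_borel}) topology \<Rightarrow> (nat \<Rightarrow> 'a) \<Rightarrow>
     (nat \<Rightarrow> 'a) \<Rightarrow> nat \<Rightarrow> 'a" where
  "hankel_operator Y \<theta> x = (THE y. hankel_sums_to Y \<theta> x y)"

definition zero_neighborhood :: "(nat \<Rightarrow> 'a::zero) topology \<Rightarrow> (nat \<Rightarrow> 'a) set \<Rightarrow> bool" where
  "zero_neighborhood X U \<longleftrightarrow>
     U \<subseteq> topspace X \<and> (\<exists>V. openin X V \<and> (\<lambda>_. 0) \<in> V \<and> V \<subseteq> U)"

text \<open>Precompactness is total boundedness for the translation-invariant uniformity.\<close>

definition precompact_in :: "(nat \<Rightarrow> 'a::monoid_add) topology \<Rightarrow> (nat \<Rightarrow> 'a) set \<Rightarrow> bool" where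
  "precompact_in X S \<longleftrightarrow> S \<subseteq> topspace X \<and>
     (\<forall>V. zero_neighborhood X V \<longrightarrow>
        (\<exists>A. finite A \<and> A \<subseteq> topspace X \<and> S \<subseteq> (\<Union>c\<in>A. (\<lambda>v j. c j + v j) ` V)))"

definition linear_map_between ::
    "(nat \<Rightarrow> 'a::{real_normed_field, heine_borel}) topology \<Rightarrow> (nat \<Rightarrow> 'a) topology \<Rightarrow>
     ((nat \<Rightarrow> 'a) \<Rightarrow> nat \<Rightarrow> 'a) \<Rightarrow> bool" where
  "linear_map_between X Y T \<longleftrightarrow> T \<in> topspace X \<rightarrow> topspace Y \<and>
     (\<forall>x\<in>topspace X. \<forall>y\<in>topspace X. T (\<lambda>j. x j + y j) = (\<lambda>j. T x j + T y j)) \<and>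
     (\<forall>c. \<forall>x\<in>topspace X. T (\<lambda>j. c * x j) = (\<lambda>j. c * T x j))"

definition compact_operator ::
    "(nat \<Rightarrow> 'a::{real_normed_field, heine_borel}) topology \<Rightarrow> (nat \<Rightarrow> 'a) topology \<Rightarrow>
     ((nat \<Rightarrow> 'a) \<Rightarrow> nat \<Rightarrow> 'a) \<Rightarrow> bool" where
  "compact_operator X Y T \<longleftrightarrow>
     linear_map_between X Y T \<and> (\<exists>U. zero_neighborhood X U \<and> precompact_in Y (T ` U))"

end

theory Submission imports Defs begin

text \<open>
  Stability gives \<open>\<beta>\<^bsub>j+n-1\<^esub> \<le> M (\<beta>\<^sub>j + \<beta>\<^sub>n)\<close>, because \<open>j + n - 1 \<le> 2 max j n\<close>. Therefore
  \<open>e\<^bsup>-\<beta>\<^sub>j/k\<^esup> \<le> e\<^bsup>\<beta>\<^sub>n/k\<^esup> e\<^bsup>-\<beta>\<^bsub>j+n-1\<^esub>/(Mk)\<^esup>\<close>, so the \<open>k\<close>-th seminorm of the \<open>n\<close>-th column is at most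
  \<open>e\<^bsup>\<beta>\<^sub>n/k\<^esup>\<close> times the \<open>Mk\<close>-th seminorm of \<open>\<theta>\<close>, hence at most a constant times \<open>a\<^bsub>n,m\<^esub>\<close> with \<open>m\<close>
  independent of \<open>k\<close>. The unit ball of the \<open>m\<close>-th seminorm is thus mapped to a bounded set, and bounded
  subsets of \<open>\<Lambda>\<^sub>1(\<beta>)\<close> are precompact because \<open>e\<^bsup>-\<beta>\<^sub>n/k\<^esup> / e\<^bsup>-\<beta>\<^sub>n/(2k)\<^esup> \<rightarrow> 0\<close>.
\<close>

section \<open>Seminorms and topology of a Koethe space\<close>

lemma kothe_matrixD:
  assumes "kothe_matrix a"
  shows kothe_matrix_nonneg: "\<lbrakk>1 \<le> n; 1 \<le> k\<rbrakk> \<Longrightarrow> 0 \<le> a n k"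
    and kothe_matrix_ex_pos: "1 \<le> n \<Longrightarrow> \<exists>k\<ge>1. 0 < a n k"
  using assms by (auto simp: kothe_matrix_def)

lemma kothe_matrix_mono:
  assumes "kothe_matrix a" "1 \<le> n" "1 \<le> k" "k \<le> l"
  shows "a n k \<le> a n l"
  using assms(4)
proof (induction l rule: dec_induct)
  case (step l)
  moreover have "a n l \<le> a n (Suc l)"
    using assms step by (auto simp: kothe_matrix_def)
  ultimately show ?case by linarith
qed simp

lemma kothe_space_summable:
  "\<lbrakk>x \<in> kothe_space a; 1 \<le> k\<rbrakk> \<Longrightarrow> summable (\<lambda>n. norm (x (Suc n)) * a (Suc n) k)"
  by (simp add: kothe_space_def)

lemma kothe_space_zero [simp]: "(\<lambda>_. 0) \<in> kothe_space a"
  by (simp add: kothe_space_def)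

lemma kothe_space_diff:
  assumes "kothe_matrix a" "x \<in> kothe_space a" "y \<in> kothe_space a"
  shows "(\<lambda>n. x n - y n) \<in> kothe_space a"
proof -
  have "summable (\<lambda>n. norm (x (Suc n) - y (Suc n)) * a (Suc n) k)" if "1 \<le> k" for k
  proof (rule summable_comparison_test')
    show "summable (\<lambda>n. norm (x (Suc n)) * a (Suc n) k + norm (y (Suc n)) * a (Suc n) k)"
      using assms that by (intro summable_add kothe_space_summable)
    show "norm (norm (x (Suc n) - y (Suc n)) * a (Suc n) k)
        \<le> norm (x (Suc n)) * a (Suc n) k + norm (y (Suc n)) * a (Suc n) k" for n
      using kothe_matrix_nonneg[OF assms(1), of "Suc n" k] that
      by (simp add: abs_mult norm_triangle_ineq4 mult_right_mono flip: distrib_right)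
  qed
  then show ?thesis
    using assms by (simp add: kothe_space_def)
qed

lemma kothe_space_scale:
  assumes "x \<in> kothe_space a"
  shows "(\<lambda>n. c * x n) \<in> kothe_space a"
  using assms by (auto simp: kothe_space_def norm_mult mult.assoc intro!: summable_mult)

lemma kothe_space_add:
  assumes "kothe_matrix a" "x \<in> kothe_space a" "y \<in> kothe_space a"
  shows "(\<lambda>n. x n + y n) \<in> kothe_space a"
  using kothe_space_diff[OF assms(1,2) kothe_space_scale[OF assms(3), of "- 1"]] by simp

lemma kothe_space_sum:
  assumes "kothe_matrix a" "\<And>i. i \<in> I \<Longrightarrow> f i \<in> kothe_space a"
  shows "(\<lambda>n. \<Sum>i\<in>I. f i n) \<in> kothe_space a"
  using assms(2)
proof (induction I rule: infinite_finite_induct)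
  case (insert i I)
  then show ?case
    using kothe_space_add[OF assms(1), of "f i" "\<lambda>n. \<Sum>i\<in>I. f i n"] by simp
qed simp_all

lemma kothe_seminorm_mono:
  assumes "kothe_matrix a" "x \<in> kothe_space a" "1 \<le> k" "k \<le> l"
  shows "kothe_seminorm a k x \<le> kothe_seminorm a l x"
  unfolding kothe_seminorm_def using assms
  by (intro suminf_le mult_left_mono kothe_matrix_mono kothe_space_summable) auto

lemma coordinate_le_kothe_seminorm:
  assumes "kothe_matrix a" "x \<in> kothe_space a" "1 \<le> k" "1 \<le> n"
  shows "norm (x n) * a n k \<le> kothe_seminorm a k x"
proof -
  have "(\<Sum>i\<in>{n - 1}. norm (x (Suc i)) * a (Suc i) k) \<le> kothe_seminorm a k x"
    unfolding kothe_seminorm_def using assms kothe_matrix_nonneg[OF assms(1)]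
    by (intro sum_le_suminf kothe_space_summable) auto
  then show ?thesis using assms by simp
qed

lemma kothe_seminorm_nonneg:
  assumes "kothe_matrix a" "x \<in> kothe_space a" "1 \<le> k"
  shows "0 \<le> kothe_seminorm a k x"
  unfolding kothe_seminorm_def using assms kothe_matrix_nonneg[OF assms(1)]
  by (intro suminf_nonneg kothe_space_summable) auto

lemma kothe_seminorm_minus_commute:
  "kothe_seminorm a k (\<lambda>n. x n - y n) = kothe_seminorm a k (\<lambda>n. y n - x n)"
  by (simp add: kothe_seminorm_def norm_minus_commute)

lemma kothe_seminorm_triangle:
  assumes "kothe_matrix a" "1 \<le> k"
    and "x \<in> kothe_space a" "y \<in> kothe_space a" "z \<in> kothe_space a"
  shows "kothe_seminorm a k (\<lambda>n. x n - z n)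
    \<le> kothe_seminorm a k (\<lambda>n. x n - y n) + kothe_seminorm a k (\<lambda>n. y n - z n)"
proof -
  have s: "summable (\<lambda>n. norm (u (Suc n) - v (Suc n)) * a (Suc n) k)"
    if "u \<in> kothe_space a" "v \<in> kothe_space a" for u v :: "nat \<Rightarrow> 'a"
    using kothe_space_summable[OF kothe_space_diff[OF assms(1) that] assms(2)] by simp
  have "norm (x (Suc n) - z (Suc n)) * a (Suc n) k
      \<le> norm (x (Suc n) - y (Suc n)) * a (Suc n) k + norm (y (Suc n) - z (Suc n)) * a (Suc n) k" for n
    unfolding distrib_right[symmetric] using kothe_matrix_nonneg[OF assms(1), of "Suc n" k] assms(2)
      norm_triangle_ineq[of "x (Suc n) - y (Suc n)" "y (Suc n) - z (Suc n)"]
    by (intro mult_right_mono) auto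
  then show ?thesis
    unfolding kothe_seminorm_def suminf_add[OF s[OF assms(3,4)] s[OF assms(4,5)]]
    using assms by (intro suminf_le summable_add s) auto
qed

section \<open>Neighbourhood bases, separation and convergence\<close>

lemma openin_kothe_ball:
  assumes "x \<in> kothe_space a" "1 \<le> k" "0 < r"
  shows "openin (kothe_topology a) {y \<in> kothe_space a. kothe_seminorm a k (\<lambda>n. y n - x n) < r}"
  unfolding kothe_topology_def using assms by (intro topology_generated_by_Basis) blast

text \<open>The generating balls have arbitrary centres and form only a subbase. Induction on the
  generation of open sets turns this into a neighbourhood base of balls centred at \<open>x\<close>
  itself, so that later arguments deal with one seminorm at a time.\<close>

lemma openin_kothe_topologyD:
  assumes a: "kothe_matrix a" and V: "openin (kothe_topology a) V" and x: "x \<in> V"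
  shows "\<exists>k\<ge>1. \<exists>r>0. {y \<in> kothe_space a. kothe_seminorm a k (\<lambda>n. y n - x n) < r} \<subseteq> V"
proof -
  let ?ball = "\<lambda>x k r. {y \<in> kothe_space a. kothe_seminorm a k (\<lambda>n. y n - x n) < r}"
  have "generate_topology_on {?ball x k r | x k r. x \<in> kothe_space a \<and> 1 \<le> k \<and> 0 < r} V"
    using V by (simp add: kothe_topology_def openin_topology_generated_by_iff)
  then have "x \<in> V \<longrightarrow> (\<exists>k\<ge>1. \<exists>r>0. ?ball x k r \<subseteq> V)"
  proof (induction rule: generate_topology_on.induct)
    case Empty
    then show ?case by simp
  next
    case (Int A B)
    show ?case
    proof
      assume "x \<in> A \<inter> B"
      with Int obtain k r l s where kr: "k \<ge> 1" "r > 0" "?ball x k r \<subseteq> A"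
        and ls: "l \<ge> 1" "s > 0" "?ball x l s \<subseteq> B"
        by auto
      have x': "x \<in> kothe_space a"
        using x openin_subset[OF V] by auto
      \<comment> \<open>Seminorms increase with the index, so the larger index and the smaller
        radius serve both balls.\<close>
      have "?ball x (max k l) (min r s) \<subseteq> ?ball x k r \<inter> ?ball x l s"
        using kothe_seminorm_mono[OF a kothe_space_diff[OF a _ x'] kr(1), of _ "max k l"]
          kothe_seminorm_mono[OF a kothe_space_diff[OF a _ x'] ls(1), of _ "max k l"]
        by (force intro: le_less_trans)
      with kr ls have "?ball x (max k l) (min r s) \<subseteq> A \<inter> B"
        by blast
      with kr ls show "\<exists>k\<ge>1. \<exists>r>0. ?ball x k r \<subseteq> A \<inter> B"
        by (intro exI[of _ "max k l"] exI[of _ "min r s"] conjI) auto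
    qed
  next
    case (UN \<A>)
    then show ?case by (meson Union_iff Union_upper order_trans)
  next
    case (Basis S)
    then obtain c k s where S: "S = ?ball c k s" and c: "c \<in> kothe_space a" and k: "1 \<le> k"
      by blast
    show ?case
    proof
      assume xS: "x \<in> S"
      \<comment> \<open>The room left between \<open>x\<close> and the boundary of the ball around
        \<open>c\<close>; the triangle inequality does the rest.\<close>
      define r where "r = s - kothe_seminorm a k (\<lambda>n. x n - c n)"
      have "r > 0" using xS by (simp add: S r_def)
      moreover have "?ball x k r \<subseteq> S"
      proof
        fix y assume y: "y \<in> ?ball x k r"
        with kothe_seminorm_triangle[OF a k, of y x c] xS c show "y \<in> S"
          by (auto simp: S r_def)
      qed
      ultimately show "\<exists>k\<ge>1. \<exists>r>0. ?ball x k r \<subseteq> S" using k by blast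
    qed
  qed
  with x show ?thesis by blast
qed

text \<open>Makes the limit in \<open>hankel_sums_to\<close> unique, so that the definite
  description in \<open>hankel_operator\<close> is meaningful. Separation holds because every
  coordinate is seen by some seminorm.\<close>

lemma Hausdorff_kothe_topology:
  assumes a: "kothe_matrix a"
  shows "Hausdorff_space (kothe_topology a :: (nat \<Rightarrow> 'a::{real_normed_field, heine_borel}) topology)"
  unfolding Hausdorff_space_def topspace_kothe_topology
proof (intro allI impI, elim conjE)
  fix x y :: "nat \<Rightarrow> 'a"
  assume x: "x \<in> kothe_space a" and y: "y \<in> kothe_space a" and "x \<noteq> y"
  then obtain n where n: "x n \<noteq> y n" by blast
  \<comment> \<open>Both sequences are normalised to vanish at index 0, so they cannot differ
    there.\<close>
  then have "1 \<le> n" using x y by (cases n) (auto simp: kothe_space_def)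
  then obtain k where k: "1 \<le> k" "0 < a n k" using kothe_matrix_ex_pos[OF a] by blast
  define r where "r = norm (x n - y n) * a n k / 2"
  have "r > 0" using n k by (simp add: r_def)
  let ?ball = "\<lambda>x. {z \<in> kothe_space a. kothe_seminorm a k (\<lambda>n. z n - x n) < r}"
  have "2 * r \<le> kothe_seminorm a k (\<lambda>n. x n - y n)"
    using coordinate_le_kothe_seminorm[OF a kothe_space_diff[OF a x y] k(1) \<open>1 \<le> n\<close>]
    by (simp add: r_def)
  then have "z \<notin> ?ball y" if "z \<in> ?ball x" for z
    using kothe_seminorm_triangle[OF a k(1) x _ y, of z] that
      kothe_seminorm_minus_commute[of a k x z] by auto
  then have "disjnt (?ball x) (?ball y)"
    unfolding disjnt_iff by blast
  moreover have "u \<in> ?ball u" if "u \<in> kothe_space a" for u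
    using that \<open>r > 0\<close> by (simp add: kothe_seminorm_def)
  ultimately show "\<exists>U V. openin (kothe_topology a) U \<and> openin (kothe_topology a) V \<and>
      x \<in> U \<and> y \<in> V \<and> disjnt U V"
    using openin_kothe_ball[OF x k(1) \<open>r > 0\<close>] openin_kothe_ball[OF y k(1) \<open>r > 0\<close>] x y by blast
qed

lemma limitin_kothe_topologyI:
  assumes a: "kothe_matrix a" and y: "y \<in> kothe_space a" and f: "\<And>i. f i \<in> kothe_space a"
    and lim: "\<And>k. 1 \<le> k \<Longrightarrow> ((\<lambda>i. kothe_seminorm a k (\<lambda>n. f i n - y n)) \<longlongrightarrow> 0) F"
  shows "limitin (kothe_topology a) f y F"
  unfolding limitin_def topspace_kothe_topology
proof (intro conjI y allI impI, elim conjE)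
  fix V assume "openin (kothe_topology a) V" "y \<in> V"
  from openin_kothe_topologyD[OF a this] obtain k r where "k \<ge> 1" "r > 0"
    and *: "{z \<in> kothe_space a. kothe_seminorm a k (\<lambda>n. z n - y n) < r} \<subseteq> V" by blast
  have "\<forall>\<^sub>F i in F. kothe_seminorm a k (\<lambda>n. f i n - y n) < r"
    using order_tendstoD(2)[OF lim[OF \<open>k \<ge> 1\<close>] \<open>r > 0\<close>] .
  then show "\<forall>\<^sub>F i in F. f i \<in> V"
    by eventually_elim (use * f in blast)
qed

section \<open>Operators given by their columns\<close>

text \<open>
  The library version \<open>summable_norm_cancel\<close> asks for the class \<open>banach\<close>, which does not follow
  syntactically from completeness.
\<close>

lemma summable_norm_cancel_complete:
  fixes f :: "nat \<Rightarrow> 'a::{real_normed_vector, complete_space}"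
  assumes "summable (\<lambda>n. norm (f n))"
  shows "summable f"
proof -
  have "Cauchy (\<lambda>n. \<Sum>i<n. f i)"
  proof (rule metric_CauchyI)
    fix e :: real assume "0 < e"
    have "Cauchy (\<lambda>n. \<Sum>i<n. norm (f i))"
      using assms by (simp add: summable_iff_convergent convergent_Cauchy)
    with \<open>0 < e\<close> obtain M where
      M: "dist (\<Sum>i<m. norm (f i)) (\<Sum>i<n. norm (f i)) < e" if "m \<ge> M" "n \<ge> M" for m n
      by (metis metric_CauchyD)
    have *: "norm ((\<Sum>i<m. f i) - (\<Sum>i<n. f i)) < e" if "M \<le> n" "n \<le> m" for m n
    proof -
      have f: "(\<Sum>i<m. f i) - (\<Sum>i<n. f i) = sum f {n..<m}"
        using sum_diff_nat_ivl[of 0 n m f] that by (simp add: atLeast0LessThan)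
      have nf: "(\<Sum>i<m. norm (f i)) - (\<Sum>i<n. norm (f i)) = (\<Sum>i=n..<m. norm (f i))"
        using sum_diff_nat_ivl[of 0 n m "\<lambda>i. norm (f i)"] that by (simp add: atLeast0LessThan)
      show ?thesis
        using M[of m n] that norm_sum[of f "{n..<m}"]
        by (simp add: dist_norm sum_nonneg f nf)
    qed
    show "\<exists>M. \<forall>m\<ge>M. \<forall>n\<ge>M. dist (\<Sum>i<m. f i) (\<Sum>i<n. f i) < e"
    proof (intro exI[of _ M] allI impI)
      fix m n assume "M \<le> m" "M \<le> n"
      then show "dist (\<Sum>i<m. f i) (\<Sum>i<n. f i) < e"
        using *[of n m] *[of m n]
        by (cases "n \<le> m") (auto simp: dist_norm norm_minus_commute)
    qed
  qed
  then show ?thesis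
    by (simp add: summable_iff_convergent Cauchy_convergent_iff)
qed

text \<open>The terms are non-negative, so one bound on all partial sums gives membership and the
  norm estimate together.\<close>

lemma kothe_seminorm_le:
  assumes "\<And>J. (\<Sum>j<J. norm (x (Suc j)) * a (Suc j) k) \<le> B"
    and "kothe_matrix a" "1 \<le> k"
  shows "summable (\<lambda>j. norm (x (Suc j)) * a (Suc j) k)" and "kothe_seminorm a k x \<le> B"
proof -
  show s: "summable (\<lambda>j. norm (x (Suc j)) * a (Suc j) k)"
    using assms kothe_matrix_nonneg[OF assms(2)]
    by (intro summableI_nonneg_bounded[where x = B]) auto
  show "kothe_seminorm a k x \<le> B"
    unfolding kothe_seminorm_def by (rule suminf_le_const[OF s assms(1)])
qed

text \<open>Coordinatewise candidate for the operator with columns \<open>h n\<close>: the series is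
  taken in the scalar field, and convergence in the target topology is proved afterwards.\<close>

definition column_operator ::
    "(nat \<Rightarrow> nat \<Rightarrow> 'a::{real_normed_field, heine_borel}) \<Rightarrow> (nat \<Rightarrow> 'a) \<Rightarrow> nat \<Rightarrow> 'a" where
  "column_operator h x j = (\<Sum>n. x (Suc n) * h (Suc n) j)"

text \<open>The constant \<open>C k\<close> may depend on the target seminorm, but the index
  \<open>m\<close> may not. Hence a single ball of the domain is mapped to a set bounded in every
  seminorm.\<close>

locale bounded_columns =
  fixes a b :: "nat \<Rightarrow> nat \<Rightarrow> real" and h :: "nat \<Rightarrow> nat \<Rightarrow> 'a::{real_normed_field, heine_borel}"
    and m :: nat and C :: "nat \<Rightarrow> real"
  assumes a: "kothe_matrix a" and b: "kothe_matrix b"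
    and m: "1 \<le> m"
    and col: "1 \<le> n \<Longrightarrow> h n \<in> kothe_space b"
    and bound: "\<lbrakk>1 \<le> n; 1 \<le> k\<rbrakk> \<Longrightarrow> kothe_seminorm b k (h n) \<le> C k * a n m"
begin

lemma summable_column_norms:
  assumes "x \<in> kothe_space a"
  shows "summable (\<lambda>n. norm (x (Suc n)) * norm (h (Suc n) j))"
proof (cases "j = 0")
  case True
  then show ?thesis using col by (simp add: kothe_space_def)
next
  case False
  \<comment> \<open>A seminorm that sees coordinate \<open>j\<close> controls the
    \<open>j\<close>-th entries of all columns at once.\<close>
  then obtain k where k: "1 \<le> k" "0 < b j k" using kothe_matrix_ex_pos[OF b, of j] by auto
  show ?thesis
  proof (rule summable_comparison_test')
    show "summable (\<lambda>n. C k / b j k * (norm (x (Suc n)) * a (Suc n) m))"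
      using assms m by (intro summable_mult kothe_space_summable)
    fix n
    have "norm (h (Suc n) j) * b j k \<le> C k * a (Suc n) m"
      using coordinate_le_kothe_seminorm[OF b col k(1), of "Suc n" j] bound[OF _ k(1), of "Suc n"] False
      by simp
    then have "norm (h (Suc n) j) \<le> C k / b j k * a (Suc n) m"
      using k by (simp add: field_simps)
    from mult_left_mono[OF this, of "norm (x (Suc n))"]
    show "norm (norm (x (Suc n)) * norm (h (Suc n) j)) \<le> C k / b j k * (norm (x (Suc n)) * a (Suc n) m)"
      by (simp add: mult_ac)
  qed
qed

lemma summable_column_operator:
  assumes "x \<in> kothe_space a"
  shows "summable (\<lambda>n. x (Suc n) * h (Suc n) j)"
  by (rule summable_norm_cancel_complete)
     (use summable_column_norms[OF assms, of j] in \<open>simp add: norm_mult\<close>)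

text \<open>Treating the remainder after \<open>N\<close> columns covers two uses:
  \<open>N = 0\<close> gives membership and continuity of the operator, and \<open>N\<close> tending
  to infinity gives convergence of the column series.\<close>

lemma column_operator_remainder:
  assumes x: "x \<in> kothe_space a" and k: "1 \<le> k"
  defines "y \<equiv> \<lambda>N j. column_operator h x j - (\<Sum>n<N. x (Suc n) * h (Suc n) j)"
    and "R \<equiv> \<lambda>N. C k * (\<Sum>n. norm (x (Suc (n + N))) * a (Suc (n + N)) m)"
  shows "summable (\<lambda>j. norm (y N (Suc j)) * b (Suc j) k)" and "kothe_seminorm b k (y N) \<le> R N"
proof -
  have sN: "summable (\<lambda>n. norm (x (Suc (n + N))) * norm (h (Suc (n + N)) j))" for j
    using summable_iff_shift[of "\<lambda>n. norm (x (Suc n)) * norm (h (Suc n) j)" N]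
      summable_column_norms[OF x] by simp
  have sa: "summable (\<lambda>n. norm (x (Suc (n + N))) * a (Suc (n + N)) m)"
    using summable_iff_shift[of "\<lambda>n. norm (x (Suc n)) * a (Suc n) m" N]
      kothe_space_summable[OF x m] by simp
  have y: "norm (y N j) \<le> (\<Sum>n. norm (x (Suc (n + N))) * norm (h (Suc (n + N)) j))" for j
  proof -
    have sm: "summable (\<lambda>n. x (Suc (n + N)) * h (Suc (n + N)) j)"
      by (rule summable_norm_cancel_complete) (use sN[of j] in \<open>simp add: norm_mult\<close>)
    have "y N j = (\<Sum>n. x (Suc (n + N)) * h (Suc (n + N)) j)"
      using suminf_minus_initial_segment[OF summable_column_operator[OF x], of N j]
      by (simp add: y_def column_operator_def)
    moreover have "norm (\<Sum>n. x (Suc (n + N)) * h (Suc (n + N)) j)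
        \<le> (\<Sum>n. norm (x (Suc (n + N))) * norm (h (Suc (n + N)) j))"
    \<comment> \<open>The triangle inequality for the infinite series is the limit of the finite
      one.\<close>
    proof (rule LIMSEQ_le[OF tendsto_norm[OF summable_LIMSEQ[OF sm]] summable_LIMSEQ[OF sN]])
      show "\<exists>K. \<forall>n\<ge>K. norm (\<Sum>i<n. x (Suc (i + N)) * h (Suc (i + N)) j)
          \<le> (\<Sum>i<n. norm (x (Suc (i + N))) * norm (h (Suc (i + N)) j))"
        by (intro exI allI impI sum_norm_le) (simp add: norm_mult)
    qed
    ultimately show ?thesis by simp
  qed
  have partial: "(\<Sum>j<J. norm (y N (Suc j)) * b (Suc j) k) \<le> R N" for J
  proof -
    let ?c = "\<lambda>j n. norm (x (Suc (n + N))) * norm (h (Suc (n + N)) (Suc j)) * b (Suc j) k"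
    have "(\<Sum>j<J. norm (y N (Suc j)) * b (Suc j) k) \<le> (\<Sum>j<J. \<Sum>n. ?c j n)"
    proof (rule sum_mono)
      fix j
      have "norm (y N (Suc j)) * b (Suc j) k
          \<le> (\<Sum>n. norm (x (Suc (n + N))) * norm (h (Suc (n + N)) (Suc j))) * b (Suc j) k"
        using kothe_matrix_nonneg[OF b _ k] by (intro mult_right_mono y) auto
      also have "\<dots> = (\<Sum>n. ?c j n)"
        by (rule suminf_mult2[OF sN])
      finally show "norm (y N (Suc j)) * b (Suc j) k \<le> (\<Sum>n. ?c j n)" .
    qed
    \<comment> \<open>Only finitely many \<open>j\<close> occur, so the exchange needs no more than
      summability over \<open>n\<close> for each \<open>j\<close>.\<close>
    also have "\<dots> = (\<Sum>n. \<Sum>j<J. ?c j n)"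
      by (intro suminf_sum[symmetric] summable_mult2 sN)
    also have "\<dots> \<le> (\<Sum>n. C k * (norm (x (Suc (n + N))) * a (Suc (n + N)) m))"
    proof (intro suminf_le summable_sum summable_mult summable_mult2 sN sa)
      fix n
      have "(\<Sum>j<J. norm (h (Suc (n + N)) (Suc j)) * b (Suc j) k) \<le> kothe_seminorm b k (h (Suc (n + N)))"
        unfolding kothe_seminorm_def using col k kothe_matrix_nonneg[OF b _ k]
        by (intro sum_le_suminf kothe_space_summable) auto
      also have "\<dots> \<le> C k * a (Suc (n + N)) m"
        using bound[OF _ k] by simp
      finally have "norm (x (Suc (n + N))) * (\<Sum>j<J. norm (h (Suc (n + N)) (Suc j)) * b (Suc j) k)
          \<le> norm (x (Suc (n + N))) * (C k * a (Suc (n + N)) m)"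
        by (rule mult_left_mono) simp
      then show "(\<Sum>j<J. ?c j n) \<le> C k * (norm (x (Suc (n + N))) * a (Suc (n + N)) m)"
        by (simp add: sum_distrib_left mult_ac)
    qed
    also have "\<dots> = R N"
      unfolding R_def by (rule suminf_mult[OF sa])
    finally show ?thesis .
  qed
  show "summable (\<lambda>j. norm (y N (Suc j)) * b (Suc j) k)" "kothe_seminorm b k (y N) \<le> R N"
    using kothe_seminorm_le[of "y N", OF partial b k] by auto
qed

lemma column_operator_in_kothe_space:
  assumes "x \<in> kothe_space a"
  shows "column_operator h x \<in> kothe_space b"
  \<comment> \<open>For \<open>N = 0\<close> the subtracted sum is empty. The value at index 0
    vanishes because it does so for every column.\<close>
  using column_operator_remainder(1)[OF assms, of _ 0] col
  by (simp add: kothe_space_def) (simp add: column_operator_def)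

lemma kothe_seminorm_column_operator_le:
  assumes "x \<in> kothe_space a" "1 \<le> k"
  shows "kothe_seminorm b k (column_operator h x) \<le> C k * kothe_seminorm a m x"
  using column_operator_remainder(2)[OF assms, of 0] by (simp add: kothe_seminorm_def)

lemma column_operator_limitin:
  assumes x: "x \<in> kothe_space a"
  shows "limitin (kothe_topology b) (\<lambda>N j. \<Sum>n=1..N. x n * h n j) (column_operator h x) sequentially"
proof (rule limitin_kothe_topologyI[OF b column_operator_in_kothe_space[OF x]])
  show "(\<lambda>j. \<Sum>n=1..N. x n * h n j) \<in> kothe_space b" for N
    using col by (intro kothe_space_sum[OF b] kothe_space_scale) auto
  fix k :: nat assume k: "1 \<le> k"
  let ?S = "\<lambda>N j. \<Sum>n=1..N. x n * h n j"
  have S: "?S N j = (\<Sum>n<N. x (Suc n) * h (Suc n) j)" for N j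
    by (rule sum.reindex_bij_witness[of _ Suc "\<lambda>n. n - 1"]) auto
  show "(\<lambda>N. kothe_seminorm b k (\<lambda>j. ?S N j - column_operator h x j)) \<longlonglongrightarrow> 0"
  proof (rule tendsto_sandwich[OF always_eventually always_eventually tendsto_const])
    show "\<forall>N. 0 \<le> kothe_seminorm b k (\<lambda>j. ?S N j - column_operator h x j)"
      using col by (intro allI kothe_seminorm_nonneg[OF b _ k] kothe_space_diff[OF b]
          kothe_space_sum[OF b] kothe_space_scale column_operator_in_kothe_space x) auto
    show "\<forall>N. kothe_seminorm b k (\<lambda>j. ?S N j - column_operator h x j)
        \<le> C k * (\<Sum>n. norm (x (Suc (n + N))) * a (Suc (n + N)) m)"
      using column_operator_remainder(2)[OF x k]
      unfolding S kothe_seminorm_minus_commute[of b k _ "column_operator h x"] by blast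
    \<comment> \<open>These are the tails of the convergent series for the \<open>m\<close>-th
      seminorm of \<open>x\<close>.\<close>
    have "(\<lambda>N. \<Sum>n. norm (x (Suc (n + N))) * a (Suc (n + N)) m) \<longlonglongrightarrow> 0"
      using suminf_exist_split2[OF kothe_space_summable[OF x m]] by simp
    then show "(\<lambda>N. C k * (\<Sum>n. norm (x (Suc (n + N))) * a (Suc (n + N)) m)) \<longlonglongrightarrow> 0"
      by (rule tendsto_mult_right_zero)
  qed
qed

lemma linear_column_operator:
  "linear_map_between (kothe_topology a) (kothe_topology b) (column_operator h)"
  unfolding linear_map_between_def topspace_kothe_topology
proof (intro conjI ballI allI ext)
  show "column_operator h \<in> kothe_space a \<rightarrow> kothe_space b"
    using column_operator_in_kothe_space by blast
  show "column_operator h (\<lambda>j. x j + y j) j = column_operator h x j + column_operator h y j"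
    if "x \<in> kothe_space a" "y \<in> kothe_space a" for x y j
    using suminf_add[OF summable_column_operator[OF that(1)] summable_column_operator[OF that(2)]]
    by (simp add: column_operator_def distrib_right)
  show "column_operator h (\<lambda>j. c * x j) j = c * column_operator h x j"
    if "x \<in> kothe_space a" for c x j
    using suminf_mult[OF summable_column_operator[OF that], of c]
    by (simp add: column_operator_def mult.assoc)
qed

end

section \<open>Bounded sets are precompact in Schwartz spaces\<close>

text \<open>By the Heine-Borel property of the scalars the closure is compact, hence totally
  bounded.\<close>

lemma bounded_imp_finite_net:
  fixes S :: "'a::heine_borel set"
  assumes "bounded S" "0 < e"
  shows "\<exists>T. finite T \<and> (\<forall>s\<in>S. \<exists>t\<in>T. dist s t < e)"
proof -
  have "compact (closure S)" using assms(1) by (simp add: compact_closure)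
  then obtain T where "finite T" "closure S \<subseteq> (\<Union>t\<in>T. ball t e)"
    using assms(2) by (auto simp: compact_eq_totally_bounded)
  then show ?thesis
    using closure_subset[of S] by (intro exI[of _ T]) (force simp: dist_commute)
qed

text \<open>The Schwartz condition makes the tails of all members of \<open>S\<close> uniformly
  small in the \<open>k\<close>-th seminorm, because their \<open>l\<close>-th seminorms are
  bounded. The remaining finitely many coordinates are bounded scalars and are approximated by
  finite nets.\<close>

lemma precompact_in_kothe_topology:
  fixes S :: "(nat \<Rightarrow> 'a::{real_normed_field, heine_borel}) set"
  assumes b: "kothe_matrix b"
    and schwartz: "\<And>k. 1 \<le> k \<Longrightarrow> \<exists>l\<ge>1. \<forall>\<epsilon>>0. \<forall>\<^sub>F n in sequentially. b n k \<le> \<epsilon> * b n l"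
    and S: "S \<subseteq> kothe_space b"
    and bdd: "\<And>k s. 1 \<le> k \<Longrightarrow> s \<in> S \<Longrightarrow> kothe_seminorm b k s \<le> B k"
  shows "precompact_in (kothe_topology b) S"
  unfolding precompact_in_def topspace_kothe_topology
proof (intro conjI S allI impI)
  fix V :: "(nat \<Rightarrow> 'a) set" assume "zero_neighborhood (kothe_topology b) V"
  then obtain W where "openin (kothe_topology b) W" "(\<lambda>_. 0) \<in> W" "W \<subseteq> V"
    by (auto simp: zero_neighborhood_def)
  with openin_kothe_topologyD[OF b, of W "\<lambda>_. 0"] obtain k r where k: "k \<ge> 1" and r: "r > 0"
    and V: "{y \<in> kothe_space b. kothe_seminorm b k y < r} \<subseteq> V"
    by auto
  obtain l where l: "l \<ge> 1" and bl: "\<And>\<epsilon>. \<epsilon> > 0 \<Longrightarrow> \<forall>\<^sub>F n in sequentially. b n k \<le> \<epsilon> * b n l"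
    using schwartz[OF k] by blast
  \<comment> \<open>Chosen so that the tail contributes at most \<open>r / 2\<close>. As
    \<open>S\<close> may be empty, \<open>B l\<close> may be negative, hence the absolute value;
    adding 1 avoids division by zero.\<close>
  define \<epsilon> where "\<epsilon> = r / (2 * (\<bar>B l\<bar> + 1))"
  have \<epsilon>: "\<epsilon> > 0" using r by (simp add: \<epsilon>_def)
  obtain N where N: "\<And>n. n \<ge> N \<Longrightarrow> b n k \<le> \<epsilon> * b n l"
    using bl[OF \<epsilon>] by (auto simp: eventually_sequentially)
  define D where "D = (\<Sum>n<N. b (Suc n) k)"
  have D: "D \<ge> 0" unfolding D_def using kothe_matrix_nonneg[OF b _ k] by (intro sum_nonneg) auto
  \<comment> \<open>Mesh of the coordinate nets. With \<open>D\<close> the total weight of the first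
    \<open>N\<close> coordinates, they contribute strictly less than \<open>r / 2\<close>.\<close>
  define \<delta> where "\<delta> = r / (2 * (D + 1))"
  have \<delta>: "\<delta> > 0" using r D by (simp add: \<delta>_def)
  have "\<exists>T. finite T \<and> (\<forall>s\<in>S. \<exists>t\<in>T. dist (s n) t < \<delta>)" if n: "1 \<le> n" for n
  proof -
    obtain i where i: "1 \<le> i" "0 < b n i" using kothe_matrix_ex_pos[OF b n] by blast
    have "norm (s n) \<le> B i / b n i" if "s \<in> S" for s
      using coordinate_le_kothe_seminorm[OF b _ i(1) n, of s] bdd[OF i(1) that] that S i
      by (auto simp: field_simps)
    then have "bounded ((\<lambda>s. s n) ` S)" by (auto simp: bounded_iff)
    from bounded_imp_finite_net[OF this \<delta>] show ?thesis by auto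
  qed
  then obtain T where T: "\<And>n. 1 \<le> n \<Longrightarrow> finite (T n)"
    "\<And>n s. 1 \<le> n \<Longrightarrow> s \<in> S \<Longrightarrow> \<exists>t\<in>T n. dist (s n) t < \<delta>"
    by metis
  \<comment> \<open>Centres are supported on \<open>{1..N}\<close>. Values from the union of the
    nets, rather than from the net of each coordinate, keep the codomain fixed, so that finiteness
    is that of a set of functions between finite sets.\<close>
  define A where "A = {c. \<forall>n. (n \<in> {1..N} \<longrightarrow> c n \<in> (\<Union>i\<in>{1..N}. T i)) \<and> (n \<notin> {1..N} \<longrightarrow> c n = 0)}"
  have A_space: "c \<in> kothe_space b" if "c \<in> A" for c
  proof -
    have c: "c n = 0" if "n \<notin> {1..N}" for n using \<open>c \<in> A\<close> that by (auto simp: A_def)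
    have "summable (\<lambda>n. norm (c (Suc n)) * b (Suc n) i)" for i
      by (rule summable_finite[of "{..<N}"]) (auto simp: c)
    then show ?thesis using c[of 0] by (simp add: kothe_space_def)
  qed
  show "\<exists>A. finite A \<and> A \<subseteq> kothe_space b \<and> S \<subseteq> (\<Union>c\<in>A. (\<lambda>v j. c j + v j) ` V)"
  proof (intro exI[of _ A] conjI subsetI)
    show "finite A" unfolding A_def using T by (intro finite_set_of_finite_funs) auto
    show "c \<in> kothe_space b" if "c \<in> A" for c by (rule A_space[OF that])
    fix s assume s: "s \<in> S"
    then have s': "s \<in> kothe_space b" using S by blast
    obtain t where t: "\<And>n. 1 \<le> n \<Longrightarrow> t n \<in> T n \<and> dist (s n) (t n) < \<delta>"
      using T(2)[OF _ s] by metis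
    define c where "c n = (if n \<in> {1..N} then t n else 0)" for n
    have c: "c \<in> A" using t by (fastforce simp: A_def c_def)
    define v where "v n = s n - c n" for n
    have v: "v \<in> kothe_space b" unfolding v_def by (rule kothe_space_diff[OF b s' A_space[OF c]])
    have "kothe_seminorm b k v = (\<Sum>n. norm (v (Suc (n + N))) * b (Suc (n + N)) k)
        + (\<Sum>n<N. norm (v (Suc n)) * b (Suc n) k)"
      unfolding kothe_seminorm_def by (rule suminf_split_initial_segment[OF kothe_space_summable[OF v k], simplified])
    also have "(\<Sum>n<N. norm (v (Suc n)) * b (Suc n) k) \<le> \<delta> * D"
      unfolding D_def sum_distrib_left using t kothe_matrix_nonneg[OF b _ k]
      by (intro sum_mono mult_right_mono) (auto simp: v_def c_def dist_norm less_imp_le)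
    also have "\<delta> * D < r / 2"
      using r D by (simp add: \<delta>_def field_simps)
    also have "(\<Sum>n. norm (v (Suc (n + N))) * b (Suc (n + N)) k) \<le> \<epsilon> * B l"
    proof -
      have sl: "summable (\<lambda>n. norm (s (Suc n)) * b (Suc n) l)"
        by (rule kothe_space_summable[OF s' l])
      have sl': "summable (\<lambda>n. norm (s (Suc (n + N))) * b (Suc (n + N)) l)"
        using summable_iff_shift[of "\<lambda>n. norm (s (Suc n)) * b (Suc n) l" N] sl by simp
      have sv: "summable (\<lambda>n. norm (v (Suc (n + N))) * b (Suc (n + N)) k)"
        using summable_iff_shift[of "\<lambda>n. norm (v (Suc n)) * b (Suc n) k" N]
          kothe_space_summable[OF v k] by simp
      \<comment> \<open>Beyond \<open>N\<close> the centre \<open>c\<close> vanishes, so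
        \<open>v\<close> agrees with \<open>s\<close> and the Schwartz estimate applies
        termwise.\<close>
      have "(\<Sum>n. norm (v (Suc (n + N))) * b (Suc (n + N)) k)
          \<le> (\<Sum>n. \<epsilon> * (norm (s (Suc (n + N))) * b (Suc (n + N)) l))"
      proof (intro suminf_le sv summable_mult sl')
        fix n
        show "norm (v (Suc (n + N))) * b (Suc (n + N)) k \<le> \<epsilon> * (norm (s (Suc (n + N))) * b (Suc (n + N)) l)"
          using mult_left_mono[OF N[of "Suc (n + N)"], of "norm (s (Suc (n + N)))"]
          by (simp add: v_def c_def mult_ac)
      qed
      also have "\<dots> = \<epsilon> * (\<Sum>n. norm (s (Suc (n + N))) * b (Suc (n + N)) l)"
        by (rule suminf_mult[OF sl'])
      also have "(\<Sum>n. norm (s (Suc (n + N))) * b (Suc (n + N)) l) \<le> kothe_seminorm b l s"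
        unfolding kothe_seminorm_def suminf_split_initial_segment[OF sl, of N]
        using kothe_matrix_nonneg[OF b _ l] by (auto intro!: sum_nonneg)
      also have "kothe_seminorm b l s \<le> B l" by (rule bdd[OF l s])
      finally show ?thesis using \<epsilon> by simp
    qed
    also have "\<epsilon> * B l \<le> r / 2"
    proof -
      have "\<epsilon> * B l \<le> \<epsilon> * (\<bar>B l\<bar> + 1)" using \<epsilon> by (intro mult_left_mono) auto
      also have "\<dots> = r / 2" by (simp add: \<epsilon>_def divide_simps)
      finally show ?thesis .
    qed
    finally have "v \<in> V" using V v by auto
    moreover have "s = (\<lambda>j. c j + v j)" by (simp add: v_def)
    ultimately show "s \<in> (\<Union>c\<in>A. (\<lambda>v j. c j + v j) ` V)" using c by blast
  qed
qed

section \<open>Power series spaces of finite type\<close>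

lemma kothe_matrix_finite_type:
  assumes "\<forall>n\<ge>1. 0 \<le> \<beta> n"
  shows "kothe_matrix (finite_type_matrix \<beta>)"
proof -
  have "\<beta> n / (1 + real k) \<le> \<beta> n / real k" if "1 \<le> n" "1 \<le> k" for n k
    using assms that by (intro divide_left_mono) auto
  then show ?thesis
    by (auto simp: kothe_matrix_def finite_type_matrix_def)
qed

text \<open>The quotient of the two weights is \<open>exp (- \<beta> n / (2 * k))\<close>, which
  tends to 0; the threshold for \<open>\<beta> n\<close> comes from taking logarithms.\<close>

lemma finite_type_matrix_schwartz:
  assumes "filterlim \<beta> at_top sequentially" "1 \<le> k" "0 < \<epsilon>"
  shows "\<forall>\<^sub>F n in sequentially.
    finite_type_matrix \<beta> n k \<le> \<epsilon> * finite_type_matrix \<beta> n (2 * k)"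
proof -
  have "\<forall>\<^sub>F n in sequentially. \<beta> n \<ge> - 2 * real k * ln \<epsilon>"
    using assms(1) by (simp add: filterlim_at_top)
  then show ?thesis
  proof eventually_elim
    case (elim n)
    then have "- (1 / real k) * \<beta> n \<le> ln \<epsilon> + - (1 / real (2 * k)) * \<beta> n"
      using assms(2) by (simp add: field_simps)
    then have "exp (- (1 / real k) * \<beta> n) \<le> exp (ln \<epsilon> + - (1 / real (2 * k)) * \<beta> n)"
      by (subst exp_le_cancel_iff)
    also have "\<dots> = \<epsilon> * exp (- (1 / real (2 * k)) * \<beta> n)"
      using assms(3) by (simp only: exp_add exp_ln)
    finally show ?case unfolding finite_type_matrix_def .
  qed
qed

section \<open>Stability and the estimate for Hankel columns\<close>

lemma stable_seq_subadditive:
  assumes pos: "\<forall>n\<ge>1. 0 \<le> \<beta> n" and mono: "mono_on {1..} \<beta>" and "stable_seq \<beta>"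
  shows "\<exists>M\<ge>1. \<forall>n\<ge>1. \<forall>i. \<beta> (i + n) \<le> real M * (\<beta> (Suc i) + \<beta> n)"
proof -
  obtain L where L: "\<And>n. n \<ge> 1 \<Longrightarrow> \<beta> (2 * n) \<le> L * \<beta> n"
    using assms(3) by (auto simp: stable_seq_def)
  \<comment> \<open>A natural number at least 1, so that \<open>M * k\<close> is again the index of
    a seminorm.\<close>
  define M where "M = nat \<lceil>max L 1\<rceil>"
  have LM: "max L 1 \<le> real M" unfolding M_def by (rule real_nat_ceiling_ge)
  then have "M \<ge> 1" by simp
  moreover have "\<beta> (i + n) \<le> real M * (\<beta> (Suc i) + \<beta> n)" if n: "n \<ge> 1" for i n
  proof -
    define p where "p = max (Suc i) n"
    \<comment> \<open>Here \<open>i\<close> stands for \<open>j - 1\<close>, which avoids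
      subtraction. The condition \<open>1 \<le> n\<close> keeps \<open>i + n\<close> in the range
      where \<open>\<beta>\<close> is monotone.\<close>
    have "\<beta> (i + n) \<le> \<beta> (2 * p)"
      using n by (intro mono_onD[OF mono]) (auto simp: p_def max_def)
    also have "\<dots> \<le> L * \<beta> p" by (rule L) (simp add: p_def)
    also have "\<dots> \<le> real M * \<beta> p"
      using LM pos by (intro mult_right_mono) (auto simp: p_def)
    also have "\<dots> \<le> real M * (\<beta> (Suc i) + \<beta> n)"
      using pos n by (intro mult_left_mono) (auto simp: p_def max_def)
    finally show ?thesis .
  qed
  ultimately show ?thesis by blast
qed

text \<open>The \<open>n\<close>-th column is \<open>shift_seq \<theta>\<close> with its first
  \<open>n - 1\<close> terms removed, so after a termwise comparison of weights its norm is
  controlled by a tail of the series for \<open>\<theta>\<close>.\<close>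

lemma hankel_column_bound:
  fixes \<theta> :: "nat \<Rightarrow> 'a::{real_normed_field, heine_borel}"
  assumes pos: "\<forall>n\<ge>1. 0 \<le> \<beta> n"
    and M: "M \<ge> 1" "\<And>n i. n \<ge> 1 \<Longrightarrow> \<beta> (i + n) \<le> real M * (\<beta> (Suc i) + \<beta> n)"
    and \<theta>: "shift_seq \<theta> \<in> kothe_space (finite_type_matrix \<beta>)"
    and k: "1 \<le> k" and n: "1 \<le> n"
  defines "b \<equiv> finite_type_matrix \<beta>"
  shows "summable (\<lambda>j. norm (hankel_column \<theta> n (Suc j)) * b (Suc j) k)"
    and "kothe_seminorm b k (hankel_column \<theta> n)
      \<le> exp (1 / real k * \<beta> n) * kothe_seminorm b (M * k) (shift_seq \<theta>)"
proof -
  let ?f = "\<lambda>j. norm (shift_seq \<theta> (Suc j)) * b (Suc j) (M * k)"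
  let ?E = "exp (1 / real k * \<beta> n)"
  have b: "kothe_matrix b" unfolding b_def by (rule kothe_matrix_finite_type[OF pos])
  have Mk: "1 \<le> M * k" using M k by simp
  have f: "summable ?f" using kothe_space_summable[OF \<theta> Mk] by (simp add: b_def)
  have f': "summable (\<lambda>j. ?f (j + (n - 1)))" using f by (subst summable_iff_shift)
  have le: "norm (hankel_column \<theta> n (Suc j)) * b (Suc j) k \<le> ?E * ?f (j + (n - 1))" for j
  proof -
    \<comment> \<open>This is the subadditivity estimate divided by \<open>M * k\<close>;
      exponentiating it compares the weights.\<close>
    have "- (1 / real k) * \<beta> (Suc j) \<le> 1 / real k * \<beta> n + - (1 / real (M * k)) * \<beta> (j + n)"
      using M(2)[OF n, of j] M(1) k by (simp add: field_simps)
    then have "b (Suc j) k \<le> ?E * b (j + n) (M * k)"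
      unfolding b_def finite_type_matrix_def exp_add[symmetric] by (subst exp_le_cancel_iff)
    from mult_left_mono[OF this, of "norm (\<theta> (j + n - 1))"] show ?thesis
      using n by (simp add: hankel_column_def shift_seq_def mult_ac)
  qed
  have partial: "(\<Sum>j<J. norm (hankel_column \<theta> n (Suc j)) * b (Suc j) k)
      \<le> ?E * kothe_seminorm b (M * k) (shift_seq \<theta>)" for J
  proof -
    have nonneg: "0 \<le> ?f j" for j using kothe_matrix_nonneg[OF b _ Mk] by simp
    have "(\<Sum>j<J. norm (hankel_column \<theta> n (Suc j)) * b (Suc j) k) \<le> ?E * (\<Sum>j<J. ?f (j + (n - 1)))"
      unfolding sum_distrib_left by (intro sum_mono le)
    also have "(\<Sum>j<J. ?f (j + (n - 1))) \<le> (\<Sum>j. ?f (j + (n - 1)))"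
      using nonneg by (intro sum_le_suminf f') auto
    also have "\<dots> \<le> kothe_seminorm b (M * k) (shift_seq \<theta>)"
      unfolding kothe_seminorm_def suminf_split_initial_segment[OF f, of "n - 1"]
      using nonneg by (simp add: sum_nonneg)
    finally show ?thesis by simp
  qed
  show "summable (\<lambda>j. norm (hankel_column \<theta> n (Suc j)) * b (Suc j) k)"
    and "kothe_seminorm b k (hankel_column \<theta> n) \<le> ?E * kothe_seminorm b (M * k) (shift_seq \<theta>)"
    using kothe_seminorm_le[of "hankel_column \<theta> n", OF partial b k] by auto
qed

section \<open>Compactness of the Hankel operator\<close>

theorem proposition3p10:
  fixes \<beta> :: "nat \<Rightarrow> real"
    and a :: "nat \<Rightarrow> nat \<Rightarrow> real"
    and \<theta> :: "nat \<Rightarrow> 'a::{real_normed_field, heine_borel}"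
  assumes "\<forall>n\<ge>1. 0 \<le> \<beta> n"
    and "mono_on {1..} \<beta>"
    and "filterlim \<beta> at_top sequentially"
    and "stable_seq \<beta>"
    and "kothe_matrix a"
    and "shift_seq \<theta> \<in> kothe_space (finite_type_matrix \<beta>)"
    and "\<exists>m\<ge>1. \<forall>k\<ge>1. \<exists>C>0. \<forall>n\<ge>1. exp (1 / real k * \<beta> n) \<le> C * a n m"
  shows "hankel_exists (kothe_topology a) (Lambda1 \<beta>) \<theta> \<and>
    compact_operator (kothe_topology a) (Lambda1 \<beta>) (hankel_operator (Lambda1 \<beta>) \<theta>)"
proof -
  let ?b = "finite_type_matrix \<beta>" and ?h = "hankel_column \<theta>"
  let ?T = "column_operator ?h" and ?H = "hankel_operator (Lambda1 \<beta>) \<theta>"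
  have b: "kothe_matrix ?b" by (rule kothe_matrix_finite_type[OF assms(1)])
  obtain M where M: "M \<ge> 1" "\<And>n i. n \<ge> 1 \<Longrightarrow> \<beta> (i + n) \<le> real M * (\<beta> (Suc i) + \<beta> n)"
    using stable_seq_subadditive[OF assms(1,2,4)] by blast
  obtain m C where m: "m \<ge> 1" and C0: "\<And>k. k \<ge> 1 \<Longrightarrow> C k > 0"
    and C: "\<And>k n. k \<ge> 1 \<Longrightarrow> n \<ge> 1 \<Longrightarrow> exp (1 / real k * \<beta> n) \<le> C k * a n m"
    using assms(7) by metis
  \<comment> \<open>Product of the constants from the domination hypothesis and from the column
    estimate. It also bounds the \<open>k\<close>-th seminorm on the image of the ball chosen
    below.\<close>
  define D where "D k = C k * kothe_seminorm ?b (M * k) (shift_seq \<theta>)" for k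
  have p: "0 \<le> kothe_seminorm ?b (M * k) (shift_seq \<theta>)" if "k \<ge> 1" for k
    using that M by (intro kothe_seminorm_nonneg[OF b assms(6)]) simp
  interpret bounded_columns a ?b ?h m D
  proof
    fix n k :: nat assume n: "1 \<le> n"
    show "?h n \<in> kothe_space ?b"
      using hankel_column_bound(1)[OF assms(1) M assms(6) _ n]
      by (simp add: kothe_space_def) (simp add: hankel_column_def)
    assume k: "1 \<le> k"
    have "kothe_seminorm ?b k (?h n) \<le> exp (1 / real k * \<beta> n) * kothe_seminorm ?b (M * k) (shift_seq \<theta>)"
      by (rule hankel_column_bound(2)[OF assms(1) M assms(6) k n])
    also have "\<dots> \<le> C k * a n m * kothe_seminorm ?b (M * k) (shift_seq \<theta>)"
      by (intro mult_right_mono C k n p)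
    finally show "kothe_seminorm ?b k (?h n) \<le> D k * a n m"
      by (simp add: D_def mult_ac)
  qed (use assms(5) b m in auto)
  have sums: "hankel_sums_to (Lambda1 \<beta>) \<theta> x (?T x)" if "x \<in> kothe_space a" for x
    unfolding hankel_sums_to_def by (rule column_operator_limitin[OF that])
  \<comment> \<open>Uniqueness of limits identifies the topologically defined operator with the
    coordinatewise one, but only on the domain space.\<close>
  have H: "?H x = ?T x" if "x \<in> kothe_space a" for x
    unfolding hankel_operator_def
  proof (rule the_equality[where P = "hankel_sums_to (Lambda1 \<beta>) \<theta> x", OF sums[OF that]])
    fix y assume "hankel_sums_to (Lambda1 \<beta>) \<theta> x y"
    then show "y = ?T x"
      using sums[OF that] limitin_Hausdorff_unique[OF _ _ trivial_limit_sequentially Hausdorff_kothe_topology[OF b]]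
      unfolding hankel_sums_to_def by blast
  qed
  have "hankel_exists (kothe_topology a) (Lambda1 \<beta>) \<theta>"
    unfolding hankel_exists_def using col sums by auto
  moreover have "linear_map_between (kothe_topology a) (Lambda1 \<beta>) ?H"
    \<comment> \<open>Linearity transfers once sums and multiples are known to stay in the domain,
      where both operators agree.\<close>
    using linear_column_operator
    unfolding linear_map_between_def topspace_kothe_topology
    by (simp add: H H[OF kothe_space_add[OF assms(5)]] H[OF kothe_space_scale] Pi_iff)
  moreover have "\<exists>U. zero_neighborhood (kothe_topology a) U \<and> precompact_in (Lambda1 \<beta>) (?H ` U)"
  proof (intro exI conjI)
    \<comment> \<open>The unit ball of the seminorm supplied by the hypothesis. The subtracted 0
      keeps the form of a ball centred at the zero sequence.\<close>
    let ?U = "{x \<in> kothe_space a. kothe_seminorm a m (\<lambda>n. x n - 0) < 1}"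
    have "openin (kothe_topology a) ?U"
      using openin_kothe_ball[OF kothe_space_zero m, of 1] by simp
    then show "zero_neighborhood (kothe_topology a) ?U"
      unfolding zero_neighborhood_def
      by (intro conjI exI[of _ ?U]) (auto simp: kothe_seminorm_def)
    show "precompact_in (Lambda1 \<beta>) (?H ` ?U)"
    proof (rule precompact_in_kothe_topology[OF b, where B = D])
      show "\<exists>l\<ge>1. \<forall>\<epsilon>>0. \<forall>\<^sub>F n in sequentially. ?b n k \<le> \<epsilon> * ?b n l" if "1 \<le> k" for k
        using finite_type_matrix_schwartz[OF assms(3) that] that by (intro exI[of _ "2 * k"]) auto
      show "?H ` ?U \<subseteq> kothe_space ?b"
        using column_operator_in_kothe_space by (auto simp: H)
      fix k :: nat and s assume k: "1 \<le> k" and "s \<in> ?H ` ?U"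
      then obtain x where x: "x \<in> kothe_space a" "kothe_seminorm a m x < 1" "s = ?T x"
        by (auto simp: H)
      \<comment> \<open>The sign is needed to pass from a seminorm below 1 to the bound
        \<open>D k\<close>.\<close>
      have "D k \<ge> 0" unfolding D_def using C0[OF k] p[OF k] by simp
      then have "D k * kothe_seminorm a m x \<le> D k"
        using x(2) by (simp add: mult_left_le)
      then show "kothe_seminorm ?b k s \<le> D k"
        using kothe_seminorm_column_operator_le[OF x(1) k] x(3) by simp
    qed
  qed
  ultimately show ?thesis unfolding compact_operator_def by blast
qed

end
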